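(* There exists a bounded open set $\Omega\subset\mathbb{R}^2$ such that for all sufficiently small $t>0$, $$\sqrt{|\Omega_{-t}|}\cdot h(\Omega_{-t})<\sqrt{|\Omega|}\cdot h(\Omega).$$
   Context: $|\cdot|$ is Lebesgue measure. For a bounded set $\Omega\subset\mathbb{R}^2$, the Cheeger constant is $h(\Omega):=\inf\{P(E)/|E| : E\subset\Omega \text{ measurable},\ |E|>0\}$, where $P(E)$ is the distributional perimeter of $E$ in $\mathbb{R}^2$. For $t>0$, the inner parallel set is $\Omega_{-t}:=\{x\in\mathbb{R}^2 : B(x,t)\subset\Omega\}$, where $B(x,t)$ is the closed ball of center $x$ and radius $t$. *)

theory Defs
  imports "HOL-Analysis.Analysis"
begin

definition divergence :: "('a::euclidean_space \<Rightarrow> 'a) \<Rightarrow> 'a \<Rightarrow> real" where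
  "divergence \<phi> x = (\<Sum>b\<in>Basis. frechet_derivative \<phi> (at x) b \<bullet> b)"

text \<open>Vector fields of class \<open>C\<^sup>1\<close> with compact support; the second clause is
  continuity of all partial derivatives.\<close>

definition C1_compact_support :: "('a::euclidean_space \<Rightarrow> 'a) \<Rightarrow> bool" where
  "C1_compact_support \<phi> \<longleftrightarrow>
     (\<forall>x. \<phi> differentiable (at x)) \<and>
     (\<forall>b\<in>Basis. continuous_on UNIV (\<lambda>x. frechet_derivative \<phi> (at x) b)) \<and>
     compact (closure {x. \<phi> x \<noteq> 0})"

text \<open>Distributional (De Giorgi) perimeter in the whole space, for Lebesgue measurable sets.
  The embedding \<open>ennreal\<close> sends negative integrals to \<open>0\<close>; this does not change the
  supremum, since \<open>\<phi> = 0\<close> is admissible.\<close>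

definition perimeter :: "'a::euclidean_space set \<Rightarrow> ennreal" where
  "perimeter E =
     (SUP \<phi>\<in>{\<phi>. C1_compact_support \<phi> \<and> (\<forall>x. norm (\<phi> x) \<le> 1)}.
        ennreal (LINT x:E|lebesgue. divergence \<phi> x))"

text \<open>The infimum is taken in the extended nonnegative reals, so that sets of infinite
  perimeter do not contribute, and the constant is \<open>\<infinity>\<close> if \<open>\<Omega>\<close> has no
  measurable subset of positive measure.\<close>

definition cheeger_constant :: "'a::euclidean_space set \<Rightarrow> ennreal" where
  "cheeger_constant \<Omega> =
     (INF E\<in>{E. E \<in> sets lebesgue \<and> E \<subseteq> \<Omega> \<and> emeasure lebesgue E > 0}.
        perimeter E / emeasure lebesgue E)"

definition inner_parallel_set :: "'a::euclidean_space set \<Rightarrow> real \<Rightarrow> 'a set" where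
  "inner_parallel_set \<Omega> t = {x. cball x t \<subseteq> \<Omega>}"

end

theory Submission
  imports Defs
begin

text \<open>
  The set is a disc \<open>B\<close> of radius 2 together with a disc \<open>B'\<close> of radius 1 at positive distance
  from it. The larger disc determines the Cheeger constant, so passing to the inner parallel set
  multiplies it by \<open>2 / (2 - t)\<close>. In
  proportion, however, the area shrinks faster than that of \<open>B\<close> alone, because the smaller disc
  loses a greater share of its area. With \<open>h\<close> the Cheeger constant and \<open>V\<close> the area of the unit disc,
  the two sides of the inequality compare as
  \<open>sqrt (V * ((2 - t)\<^sup>2 + (1 - t)\<^sup>2)) * h / (2 - t) < sqrt (V * 5) * h / 2\<close>,
  which amounts to \<open>2 * (1 - t) < 2 - t\<close>.

  Thus \<open>h\<close> cancels as soon as it is positive and finite. The comparison rests on four facts: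

  \<^item> \<open>h\<close> scales like an inverse length (\<open>cheeger_constant_ball\<close>), by a change of variables in the
    test fields;
  \<^item> the Cheeger constant of two sets on opposite sides of a strip is at least the smaller of the two
    (\<open>cheeger_constant_Un_separated\<close>), because test fields for the two pieces can be glued by a
    cutoff function that is constant outside the strip;
  \<^item> \<open>h\<close> is positive (\<open>cheeger_constant_unit_ball_pos\<close>), by testing with a cut-off multiple of the
    radial field, whose divergence is bounded below on the ball;
  \<^item> \<open>h\<close> is finite (\<open>cheeger_constant_unit_ball_finite\<close>), because the indicator function of a ball is
    Lipschitz in the \<open>L\<^sup>1\<close> norm under translations.

  These facts hold in every Euclidean space; only the last computation is planar.
\<close>

section \<open>Test fields\<close>

lemma C1_compact_supportI:
  assumes D: "\<And>x. (\<phi> has_derivative \<phi>' x) (at x)"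
    and cont: "\<And>b. b \<in> Basis \<Longrightarrow> continuous_on UNIV (\<lambda>x. \<phi>' x b)"
    and supp: "bounded {x. \<phi> x \<noteq> 0}"
  shows "C1_compact_support \<phi>"
proof -
  have "frechet_derivative \<phi> (at x) = \<phi>' x" for x
    using frechet_derivative_at[OF D[of x]] by simp
  with assms show ?thesis
    unfolding C1_compact_support_def by (auto simp: differentiable_def)
qed

lemma C1_compact_supportD:
  assumes "C1_compact_support \<phi>"
  shows "(\<phi> has_derivative frechet_derivative \<phi> (at x)) (at x)"
    and "b \<in> Basis \<Longrightarrow> continuous_on UNIV (\<lambda>x. frechet_derivative \<phi> (at x) b)"
    and "bounded {x. \<phi> x \<noteq> 0}"
  using assms unfolding C1_compact_support_def
  by (simp_all add: frechet_derivative_works[symmetric])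

lemma divergence_eq:
  assumes "(\<phi> has_derivative D) (at x)"
  shows "divergence \<phi> x = (\<Sum>b\<in>Basis. D b \<bullet> b)"
  unfolding divergence_def frechet_derivative_at[OF assms, symmetric] ..

lemma C1_compact_support_zero [simp]: "C1_compact_support (\<lambda>x. 0)"
  by (rule C1_compact_supportI[where \<phi>' = "\<lambda>x h. 0"]) auto

lemma C1_compact_support_zero_derivative:
  assumes \<phi>: "C1_compact_support \<phi>" and x: "x \<notin> closure {x. \<phi> x \<noteq> 0}"
  shows "frechet_derivative \<phi> (at x) = (\<lambda>h. 0)"
proof -
  have "frechet_derivative \<phi> (at x) = frechet_derivative (\<lambda>x. 0) (at x)"
  proof (rule frechet_derivative_transform_within_open[where X = "- closure {x. \<phi> x \<noteq> 0}"])
    show "\<phi> differentiable at x"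
      by (rule differentiableI[OF C1_compact_supportD(1)[OF \<phi>]])
    show "\<phi> y = 0" if "y \<in> - closure {x. \<phi> x \<noteq> 0}" for y
      using that closure_subset[of "{x. \<phi> x \<noteq> 0}"] by auto
    show "open (- closure {x. \<phi> x \<noteq> 0})" "x \<in> - closure {x. \<phi> x \<noteq> 0}"
      using x by (auto intro: open_Compl)
  qed
  also have "\<dots> = (\<lambda>h. 0)"
    by simp
  finally show ?thesis .
qed

lemma integrable_lebesgue_continuous_compact_support:
  fixes f :: "'a::euclidean_space \<Rightarrow> real"
  assumes cont: "continuous_on UNIV f" and K: "compact K" and zero: "\<And>x. x \<notin> K \<Longrightarrow> f x = 0"
  shows "integrable lebesgue f"
proof -
  have "integrable lborel (\<lambda>x. indicator K x *\<^sub>R f x)"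
    by (rule borel_integrable_compact[OF K]) (use cont continuous_on_subset in blast)
  moreover have "(\<lambda>x. indicator K x *\<^sub>R f x) = f"
    using zero by (auto simp: fun_eq_iff indicator_def)
  moreover have "f \<in> borel_measurable lborel"
    using cont by (simp add: borel_measurable_continuous_onI)
  ultimately show ?thesis
    by (simp add: integrable_completion)
qed

lemma set_integrable_of_integrable:
  fixes f :: "'a::euclidean_space \<Rightarrow> real"
  assumes "integrable lebesgue f" "E \<in> sets lebesgue"
  shows "set_integrable lebesgue E f"
  unfolding set_integrable_def using assms by (intro integrable_mult_indicator) auto

lemma partial_derivative_facts:
  assumes \<phi>: "C1_compact_support \<phi>" and b: "b \<in> Basis"
  defines "g \<equiv> \<lambda>x. frechet_derivative \<phi> (at x) b \<bullet> b"
  shows "continuous_on UNIV g" and "integrable lebesgue g" and "\<exists>M. \<forall>x. \<bar>g x\<bar> \<le> M"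
proof -
  let ?K = "closure {x. \<phi> x \<noteq> 0}"
  show cont: "continuous_on UNIV g"
    unfolding g_def by (intro continuous_intros C1_compact_supportD(2)[OF \<phi> b])
  have K: "compact ?K"
    using C1_compact_supportD(3)[OF \<phi>] by simp
  have zero: "g x = 0" if "x \<notin> ?K" for x
    using C1_compact_support_zero_derivative[OF \<phi> that] by (simp add: g_def)
  show "integrable lebesgue g"
    by (rule integrable_lebesgue_continuous_compact_support[OF cont K zero])
  have "bounded (g ` ?K)"
    using compact_continuous_image[OF continuous_on_subset[OF cont] K] compact_imp_bounded by blast
  then obtain M where M: "\<And>x. x \<in> ?K \<Longrightarrow> \<bar>g x\<bar> \<le> M"
    unfolding bounded_iff by auto
  have "\<bar>g x\<bar> \<le> max M 0" for x
    using M[of x] zero[of x] by (cases "x \<in> ?K") auto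
  then show "\<exists>M. \<forall>x. \<bar>g x\<bar> \<le> M" by blast
qed

lemma integrable_divergence:
  assumes \<phi>: "C1_compact_support \<phi>"
  shows "integrable lebesgue (divergence \<phi>)"
  unfolding divergence_def[abs_def]
  by (intro Bochner_Integration.integrable_sum partial_derivative_facts(2)[OF \<phi>])

lemma perimeter_upper:
  assumes "C1_compact_support \<phi>" "\<And>x. norm (\<phi> x) \<le> 1"
  shows "ennreal (LINT x:E|lebesgue. divergence \<phi> x) \<le> perimeter E"
  unfolding perimeter_def using assms by (intro SUP_upper) auto

lemma perimeter_least:
  assumes "\<And>\<phi>. C1_compact_support \<phi> \<Longrightarrow> (\<And>x. norm (\<phi> x) \<le> 1) \<Longrightarrow>
    ennreal (LINT x:E|lebesgue. divergence \<phi> x) \<le> C"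
  shows "perimeter E \<le> C"
  unfolding perimeter_def using assms by (intro SUP_least) auto

section \<open>Scaling of perimeter and Cheeger constant\<close>

lemma affine_measurable_lebesgue:
  fixes c :: "'a::euclidean_space" and s :: real
  assumes "s > 0"
  shows "(\<lambda>x. s *\<^sub>R x + c) \<in> lebesgue \<rightarrow>\<^sub>M lebesgue"
    and "lebesgue = density (distr lebesgue lebesgue (\<lambda>x. s *\<^sub>R x + c)) (\<lambda>_. ennreal (s ^ DIM('a)))"
proof -
  have *: "(\<lambda>x. c + (\<Sum>j\<in>Basis. (s * (x \<bullet> j)) *\<^sub>R j)) = (\<lambda>x. s *\<^sub>R x + c)"
    unfolding scaleR_scaleR[symmetric] scaleR_sum_right[symmetric] euclidean_representation
    by (simp add: add.commute)
  show "(\<lambda>x. s *\<^sub>R x + c) \<in> lebesgue \<rightarrow>\<^sub>M lebesgue"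
    using lebesgue_affine_measurable[of "\<lambda>_. s" c] assms by (simp add: *)
  show "lebesgue = density (distr lebesgue lebesgue (\<lambda>x. s *\<^sub>R x + c)) (\<lambda>_. ennreal (s ^ DIM('a)))"
    using lebesgue_affine_euclidean[of "\<lambda>_. s" c] assms by (simp add: *)
qed

lemma affine_image_lebesgue:
  fixes c :: "'a::euclidean_space" and s :: real
  assumes "s > 0" "E \<in> sets lebesgue"
  shows "(\<lambda>x. s *\<^sub>R x + c) ` E \<in> sets lebesgue"
proof -
  let ?S = "\<lambda>x. (1/s) *\<^sub>R x + (- (1/s) *\<^sub>R c)"
  have "(\<lambda>x. s *\<^sub>R x + c) ` E = ?S -` E \<inter> space lebesgue"
  proof (intro equalityI subsetI)
    fix y assume "y \<in> ?S -` E \<inter> space lebesgue"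
    then have "?S y \<in> E" by simp
    moreover have "y = s *\<^sub>R ?S y + c"
      using assms(1) by (simp add: algebra_simps)
    ultimately show "y \<in> (\<lambda>x. s *\<^sub>R x + c) ` E" by blast
  qed (use assms(1) in \<open>auto simp: algebra_simps\<close>)
  then show ?thesis
    using measurable_sets[OF affine_measurable_lebesgue(1)[of "1/s" "- (1/s) *\<^sub>R c"] assms(2)] assms(1)
    by simp
qed

lemma set_integral_affine_image:
  fixes c :: "'a::euclidean_space" and s :: real and f :: "'a \<Rightarrow> real"
  assumes s: "s > 0" and E: "E \<in> sets lebesgue" and f: "f \<in> borel_measurable lebesgue"
  shows "(LINT x:(\<lambda>x. s *\<^sub>R x + c) ` E|lebesgue. f x) =
    s ^ DIM('a) * (LINT x:E|lebesgue. f (s *\<^sub>R x + c))"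
proof -
  let ?T = "\<lambda>x. s *\<^sub>R x + c" and ?h = "\<lambda>x. indicator ((\<lambda>x. s *\<^sub>R x + c) ` E) x *\<^sub>R f x"
  have T: "?T \<in> lebesgue \<rightarrow>\<^sub>M lebesgue"
    by (rule affine_measurable_lebesgue(1)[OF s])
  have h: "?h \<in> borel_measurable lebesgue"
    using affine_image_lebesgue[OF s E] f by (intro borel_measurable_scaleR) auto
  have inj: "indicator (?T ` E) (?T x) = (indicator E x :: real)" for x
    using s by (auto simp: indicator_def)
  have "(LINT x|lebesgue. ?h x) =
      (LINT x|density (distr lebesgue lebesgue ?T) (\<lambda>_. ennreal (s ^ DIM('a))). ?h x)"
    using affine_measurable_lebesgue(2)[OF s, of c] by simp
  also have "\<dots> = (LINT x|distr lebesgue lebesgue ?T. s ^ DIM('a) *\<^sub>R ?h x)"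
    using h s by (intro integral_density) auto
  also have "\<dots> = (LINT x|lebesgue. s ^ DIM('a) *\<^sub>R ?h (?T x))"
    using h by (intro integral_distr[OF T]) auto
  also have "\<dots> = s ^ DIM('a) * (LINT x|lebesgue. ?h (?T x))"
    by simp
  also have "(LINT x|lebesgue. ?h (?T x)) = (LINT x:E|lebesgue. f (?T x))"
    unfolding set_lebesgue_integral_def inj ..
  finally show ?thesis
    by (simp add: set_lebesgue_integral_def)
qed

text \<open>
  A test field \<open>\<phi>\<close> on the image pulls back to \<open>\<phi> \<circ> T\<close>, whose divergence gains a factor \<open>s\<close>. That
  factor stays on the left because the natural power \<open>s ^ (DIM('a) - 1)\<close> would involve truncated
  subtraction.
\<close>

lemma perimeter_affine_image:
  fixes c :: "'a::euclidean_space" and s :: real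
  assumes s: "s > 0" and E: "E \<in> sets lebesgue"
  shows "ennreal s * perimeter ((\<lambda>x. s *\<^sub>R x + c) ` E) \<le> ennreal (s ^ DIM('a)) * perimeter E"
proof -
  let ?T = "\<lambda>x. s *\<^sub>R x + c"
  have "ennreal s * ennreal (LINT x:?T ` E|lebesgue. divergence \<phi> x) \<le> ennreal (s ^ DIM('a)) * perimeter E"
    if \<phi>: "C1_compact_support \<phi>" and le: "\<And>x. norm (\<phi> x) \<le> 1" for \<phi>
  proof -
    define D where "D x = frechet_derivative \<phi> (at x)" for x
    have D: "(\<phi> has_derivative D x) (at x)" for x
      unfolding D_def by (rule C1_compact_supportD(1)[OF \<phi>])
    have lin: "D x (s *\<^sub>R h) = s *\<^sub>R D x h" for x h
      using has_derivative_bounded_linear[OF D[of x]]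
      by (simp add: bounded_linear.linear linear_scale)
    have der: "((\<lambda>x. \<phi> (?T x)) has_derivative (\<lambda>h. s *\<^sub>R D (?T x) h)) (at x)" for x
    proof -
      have "((\<lambda>x. \<phi> (?T x)) has_derivative (\<lambda>h. D (?T x) (s *\<^sub>R h))) (at x)"
        by (rule has_derivative_compose[OF _ D]) (auto intro!: derivative_eq_intros)
      then show ?thesis by (simp add: lin)
    qed
    obtain B where B: "\<And>x. \<phi> x \<noteq> 0 \<Longrightarrow> norm x \<le> B"
      using C1_compact_supportD(3)[OF \<phi>] unfolding bounded_iff by auto
    have C1: "C1_compact_support (\<lambda>x. \<phi> (?T x))"
    proof (rule C1_compact_supportI[OF der])
      show "continuous_on UNIV (\<lambda>x. s *\<^sub>R D (?T x) b)" if "b \<in> Basis" for b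
        unfolding D_def
        by (intro continuous_intros continuous_on_compose2[OF C1_compact_supportD(2)[OF \<phi> that]]) auto
      have "norm x \<le> (B + norm c) / s" if "\<phi> (?T x) \<noteq> 0" for x
      proof -
        have "s * norm x = norm (?T x - c)"
          using s by simp
        also have "\<dots> \<le> B + norm c"
          using B[OF that] norm_triangle_ineq4[of "?T x" c] by linarith
        finally show ?thesis
          using s by (simp add: field_simps)
      qed
      then show "bounded {x. \<phi> (?T x) \<noteq> 0}"
        unfolding bounded_iff by auto
    qed
    have div: "divergence (\<lambda>x. \<phi> (?T x)) x = s * divergence \<phi> (?T x)" for x
      unfolding divergence_eq[OF der] divergence_eq[OF D] by (simp add: sum_distrib_left)
    have "ennreal s * ennreal (LINT x:?T ` E|lebesgue. divergence \<phi> x) =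
        ennreal (s * (LINT x:?T ` E|lebesgue. divergence \<phi> x))"
      using s by (simp add: ennreal_mult')
    also have "s * (LINT x:?T ` E|lebesgue. divergence \<phi> x) =
        s ^ DIM('a) * (LINT x:E|lebesgue. divergence (\<lambda>x. \<phi> (?T x)) x)"
      using set_integral_affine_image[OF s E, of "divergence \<phi>" c] integrable_divergence[OF \<phi>]
      by (simp add: div)
    also have "ennreal \<dots> = ennreal (s ^ DIM('a)) * ennreal (LINT x:E|lebesgue. divergence (\<lambda>x. \<phi> (?T x)) x)"
      using s by (simp add: ennreal_mult')
    also have "\<dots> \<le> ennreal (s ^ DIM('a)) * perimeter E"
      by (intro mult_left_mono perimeter_upper[OF C1] le) simp
    finally show ?thesis .
  qed
  then show ?thesis
    unfolding perimeter_def[of "?T ` E"] SUP_mult_left_ennreal by (intro SUP_least) auto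
qed

lemma cheeger_constant_lower:
  assumes "\<And>E. E \<in> sets lebesgue \<Longrightarrow> E \<subseteq> \<Omega> \<Longrightarrow> emeasure lebesgue E > 0 \<Longrightarrow>
    C \<le> perimeter E / emeasure lebesgue E"
  shows "C \<le> cheeger_constant \<Omega>"
  unfolding cheeger_constant_def using assms by (intro INF_greatest) auto

lemma cheeger_constant_upper:
  assumes "E \<in> sets lebesgue" "E \<subseteq> \<Omega>" "emeasure lebesgue E > 0"
  shows "cheeger_constant \<Omega> \<le> perimeter E / emeasure lebesgue E"
  unfolding cheeger_constant_def using assms by (intro INF_lower) auto

lemma cheeger_constant_antimono:
  assumes "\<Omega> \<subseteq> \<Omega>'"
  shows "cheeger_constant \<Omega>' \<le> cheeger_constant \<Omega>"
  using assms by (intro cheeger_constant_lower cheeger_constant_upper) auto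

text \<open>
  Perimeter scales with one power of \<open>s\<close> less than volume. The inequality suffices: applied to the
  inverse map it gives the reverse one.
\<close>

lemma cheeger_constant_affine_image:
  fixes c :: "'a::euclidean_space" and s :: real
  assumes s: "s > 0"
  shows "ennreal s * cheeger_constant ((\<lambda>x. s *\<^sub>R x + c) ` \<Omega>) \<le> cheeger_constant \<Omega>"
proof (rule cheeger_constant_lower)
  let ?T = "\<lambda>x. s *\<^sub>R x + c"
  fix E :: "'a set"
  assume E: "E \<in> sets lebesgue" "E \<subseteq> \<Omega>" and pos: "emeasure lebesgue E > 0"
  define k where "k = ennreal (s ^ DIM('a))"
  have k: "k \<noteq> 0" "k \<noteq> top"
    using s by (auto simp: k_def)
  have em: "emeasure lebesgue (?T ` E) = k * emeasure lebesgue E"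
    using emeasure_lebesgue_affine[of s c E] s by (simp add: k_def ennreal_power)
  then have "emeasure lebesgue (?T ` E) > 0"
    using pos k by (simp add: ennreal_zero_less_mult_iff zero_less_iff_neq_zero)
  then have "cheeger_constant (?T ` \<Omega>) \<le> perimeter (?T ` E) / emeasure lebesgue (?T ` E)"
    using E affine_image_lebesgue[OF s E(1)] by (intro cheeger_constant_upper) auto
  then have "ennreal s * cheeger_constant (?T ` \<Omega>) \<le>
      (ennreal s * perimeter (?T ` E)) / emeasure lebesgue (?T ` E)"
    unfolding ennreal_times_divide[symmetric] by (rule mult_left_mono) simp
  also have "\<dots> \<le> (k * perimeter E) / (k * emeasure lebesgue E)"
    unfolding em k_def by (rule divide_right_mono_ennreal[OF perimeter_affine_image[OF s E(1)]])
  also have "\<dots> = perimeter E / emeasure lebesgue E"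
    using divide_mult_eq[of k "perimeter E" "emeasure lebesgue E"] k by (simp add: mult.commute)
  finally show "ennreal s * cheeger_constant (?T ` \<Omega>) \<le> perimeter E / emeasure lebesgue E" .
qed

section \<open>Separated sets\<close>

text \<open>
  The squared positive part is the simplest function of class \<open>C\<^sup>1\<close> that vanishes on a half-line. All
  cutoffs below are built from it.
\<close>

lemma has_real_derivative_max_zero_square:
  "((\<lambda>v::real. (max 0 v)\<^sup>2) has_real_derivative 2 * max 0 v) (at v)"
proof -
  consider "v > 0" | "v < 0" | "v = 0" by linarith
  then show ?thesis
  proof cases
    case 1
    have "((\<lambda>v::real. v\<^sup>2) has_real_derivative 2 * max 0 v) (at v)"
      using 1 by (auto intro!: derivative_eq_intros)
    then show ?thesis
      by (rule has_field_derivative_transform_within_open[where S = "{0<..}"]) (use 1 in auto)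
  next
    case 2
    have "((\<lambda>v::real. 0) has_real_derivative 2 * max 0 v) (at v)"
      using 2 by (auto intro!: derivative_eq_intros)
    then show ?thesis
      by (rule has_field_derivative_transform_within_open[where S = "{..<0}"]) (use 2 in auto)
  next
    case 3
    have "((\<lambda>h::real. max 0 h) \<longlongrightarrow> max 0 0) (at 0)"
      by (intro tendsto_intros)
    moreover have "(\<lambda>h::real. ((max 0 (0 + h))\<^sup>2 - (max 0 0)\<^sup>2) / h) = (\<lambda>h. max 0 h)"
      by (auto simp: fun_eq_iff max_def power2_eq_square)
    ultimately show ?thesis
      unfolding 3 DERIV_def by simp
  qed
qed

text \<open>
  The quotient \<open>p / (p + q)\<close> with \<open>p\<close> and \<open>q\<close> the squared positive parts of \<open>b - v\<close> and \<open>v - a\<close>. The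
  denominator never vanishes, since for \<open>a < b\<close> every \<open>v\<close> lies below \<open>b\<close> or above \<open>a\<close>. The vanishing of
  the derivative on the closed half-lines matters: the sets to be separated may touch their ends.
\<close>

lemma C1_step_function:
  fixes a b :: real
  assumes "a < b"
  obtains \<eta> \<eta>' :: "real \<Rightarrow> real"
  where "\<And>v. (\<eta> has_real_derivative \<eta>' v) (at v)" "continuous_on UNIV \<eta>'"
    "\<And>v. 0 \<le> \<eta> v" "\<And>v. \<eta> v \<le> 1"
    "\<And>v. v \<le> a \<Longrightarrow> \<eta> v = 1 \<and> \<eta>' v = 0" "\<And>v. b \<le> v \<Longrightarrow> \<eta> v = 0 \<and> \<eta>' v = 0"
proof -
  define p where "p v = (max 0 (b - v))\<^sup>2" for v
  define q where "q v = (max 0 (v - a))\<^sup>2" for v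
  define p' where "p' v = - 2 * max 0 (b - v)" for v
  define q' where "q' v = 2 * max 0 (v - a)" for v
  define \<eta> where "\<eta> v = p v / (p v + q v)" for v
  define \<eta>' where "\<eta>' v = (p' v * (p v + q v) - p v * (p' v + q' v)) / ((p v + q v) * (p v + q v))" for v
  have nonneg: "p v \<ge> 0" "q v \<ge> 0" for v
    by (auto simp: p_def q_def)
  have pos: "p v + q v > 0" for v
  proof (cases "v < b")
    case True
    then have "p v > 0" by (simp add: p_def)
    then show ?thesis using nonneg(2)[of v] by linarith
  next
    case False
    then have "q v > 0" using assms by (simp add: q_def)
    then show ?thesis using nonneg(1)[of v] by linarith
  qed
  have dp: "(p has_real_derivative p' v) (at v)" for v
  proof -
    have "((\<lambda>v. b - v) has_real_derivative -1) (at v)"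
      by (auto intro!: derivative_eq_intros)
    from DERIV_chain2[OF has_real_derivative_max_zero_square this] show ?thesis
      unfolding p_def p'_def by simp
  qed
  have dq: "(q has_real_derivative q' v) (at v)" for v
  proof -
    have "((\<lambda>v. v - a) has_real_derivative 1) (at v)"
      by (auto intro!: derivative_eq_intros)
    from DERIV_chain2[OF has_real_derivative_max_zero_square this] show ?thesis
      unfolding q_def q'_def by simp
  qed
  show ?thesis
  proof
    show "(\<eta> has_real_derivative \<eta>' v) (at v)" for v
      unfolding \<eta>_def \<eta>'_def
      by (rule DERIV_divide[OF dp DERIV_add[OF dp dq]]) (use pos[of v] in linarith)
    have "p v + q v \<noteq> 0" for v
      using pos[of v] by linarith
    then show "continuous_on UNIV \<eta>'"
      unfolding \<eta>'_def p_def q_def p'_def q'_def by (intro continuous_intros) auto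
    show "0 \<le> \<eta> v" "\<eta> v \<le> 1" for v
      using nonneg[of v] pos[of v] by (auto simp: \<eta>_def field_simps)
    show "\<eta> v = 1 \<and> \<eta>' v = 0" if "v \<le> a" for v
    proof -
      have "q v = 0" "q' v = 0" using that by (auto simp: q_def q'_def)
      then show ?thesis using pos[of v] by (simp add: \<eta>_def \<eta>'_def)
    qed
    show "\<eta> v = 0 \<and> \<eta>' v = 0" if "b \<le> v" for v
    proof -
      have "p v = 0" "p' v = 0" using that by (auto simp: p_def p'_def)
      then show ?thesis by (simp add: \<eta>_def \<eta>'_def)
    qed
  qed
qed

lemma divergence_zero [simp]: "divergence (\<lambda>x. 0) x = 0"
  using divergence_eq[OF has_derivative_const] by simp

text \<open>
  Nearly optimal fields \<open>\<phi>\<^sub>1\<close> and \<open>\<phi>\<^sub>2\<close> for the two pieces are combined into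
  \<open>\<eta> (x \<bullet> u) *\<^sub>R \<phi>\<^sub>1 x + (1 - \<eta> (x \<bullet> u)) *\<^sub>R \<phi>\<^sub>2 x\<close>. As a pointwise convex combination it still has norm
  at most one, and it coincides to first order with \<open>\<phi>\<^sub>1\<close> on the first piece and with \<open>\<phi>\<^sub>2\<close> on the
  second.
\<close>

lemma perimeter_Un_separated:
  fixes u :: "'a::euclidean_space"
  assumes meas: "E\<^sub>1 \<in> sets lebesgue" "E\<^sub>2 \<in> sets lebesgue"
    and sep: "\<And>x. x \<in> E\<^sub>1 \<Longrightarrow> x \<bullet> u \<le> a" "\<And>x. x \<in> E\<^sub>2 \<Longrightarrow> b \<le> x \<bullet> u" and "a < b"
  shows "perimeter E\<^sub>1 + perimeter E\<^sub>2 \<le> perimeter (E\<^sub>1 \<union> E\<^sub>2)"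
proof -
  obtain \<eta> \<eta>' :: "real \<Rightarrow> real" where
      \<eta>: "\<And>v. (\<eta> has_real_derivative \<eta>' v) (at v)" "continuous_on UNIV \<eta>'"
      "\<And>v. 0 \<le> \<eta> v" "\<And>v. \<eta> v \<le> 1"
    and \<eta>_left: "\<And>v. v \<le> a \<Longrightarrow> \<eta> v = 1 \<and> \<eta>' v = 0"
    and \<eta>_right: "\<And>v. b \<le> v \<Longrightarrow> \<eta> v = 0 \<and> \<eta>' v = 0"
    using C1_step_function[OF \<open>a < b\<close>] by blast
  have \<eta>_cont: "continuous_on UNIV \<eta>"
    using DERIV_continuous[OF \<eta>(1)] continuous_at_imp_continuous_on by blast
  have disj: "E\<^sub>1 \<inter> E\<^sub>2 = {}"
    using sep \<open>a < b\<close> by force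
  have glue: "ennreal ((LINT x:E\<^sub>1|lebesgue. divergence \<phi>\<^sub>1 x) + (LINT x:E\<^sub>2|lebesgue. divergence \<phi>\<^sub>2 x))
      \<le> perimeter (E\<^sub>1 \<union> E\<^sub>2)"
    if \<phi>: "C1_compact_support \<phi>\<^sub>1" "C1_compact_support \<phi>\<^sub>2"
      and le: "\<And>x. norm (\<phi>\<^sub>1 x) \<le> 1" "\<And>x. norm (\<phi>\<^sub>2 x) \<le> 1" for \<phi>\<^sub>1 \<phi>\<^sub>2 :: "'a \<Rightarrow> 'a"
  proof -
    define \<phi> where "\<phi> x = \<eta> (x \<bullet> u) *\<^sub>R \<phi>\<^sub>1 x + (1 - \<eta> (x \<bullet> u)) *\<^sub>R \<phi>\<^sub>2 x" for x
    define D\<^sub>1 where "D\<^sub>1 x = frechet_derivative \<phi>\<^sub>1 (at x)" for x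
    define D\<^sub>2 where "D\<^sub>2 x = frechet_derivative \<phi>\<^sub>2 (at x)" for x
    define D where "D x h = (\<eta>' (x \<bullet> u) * (h \<bullet> u)) *\<^sub>R (\<phi>\<^sub>1 x - \<phi>\<^sub>2 x) +
        \<eta> (x \<bullet> u) *\<^sub>R D\<^sub>1 x h + (1 - \<eta> (x \<bullet> u)) *\<^sub>R D\<^sub>2 x h" for x h
    have D\<^sub>1: "(\<phi>\<^sub>1 has_derivative D\<^sub>1 x) (at x)" for x
      unfolding D\<^sub>1_def by (rule C1_compact_supportD(1)[OF \<phi>(1)])
    have D\<^sub>2: "(\<phi>\<^sub>2 has_derivative D\<^sub>2 x) (at x)" for x
      unfolding D\<^sub>2_def by (rule C1_compact_supportD(1)[OF \<phi>(2)])
    have d\<eta>: "((\<lambda>x. \<eta> (x \<bullet> u)) has_derivative (\<lambda>h. h \<bullet> u * \<eta>' (x \<bullet> u))) (at x)" for x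
      by (rule DERIV_compose_FDERIV[OF \<eta>(1)]) (auto intro!: derivative_eq_intros)
    have der: "(\<phi> has_derivative D x) (at x)" for x
      unfolding \<phi>_def D_def
      by (rule derivative_eq_intros d\<eta> D\<^sub>1 D\<^sub>2 refl)+ (simp add: fun_eq_iff algebra_simps)
    have \<phi>_cont: "continuous_on UNIV \<phi>\<^sub>1" "continuous_on UNIV \<phi>\<^sub>2"
      using has_derivative_continuous[OF D\<^sub>1] has_derivative_continuous[OF D\<^sub>2]
        continuous_at_imp_continuous_on by blast+
    have C1: "C1_compact_support \<phi>"
    proof (rule C1_compact_supportI[OF der])
      show "continuous_on UNIV (\<lambda>x. D x b)" if "b \<in> Basis" for b
        unfolding D_def D\<^sub>1_def D\<^sub>2_def
        by (intro continuous_intros \<phi>_cont C1_compact_supportD(2)[OF \<phi>(1) that]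
            C1_compact_supportD(2)[OF \<phi>(2) that]
            continuous_on_compose2[OF \<eta>(2)] continuous_on_compose2[OF \<eta>_cont]) auto
      have "{x. \<phi> x \<noteq> 0} \<subseteq> {x. \<phi>\<^sub>1 x \<noteq> 0} \<union> {x. \<phi>\<^sub>2 x \<noteq> 0}"
        by (auto simp: \<phi>_def)
      then show "bounded {x. \<phi> x \<noteq> 0}"
        using \<phi>[THEN C1_compact_supportD(3)] bounded_subset bounded_Un by blast
    qed
    have \<phi>_le: "norm (\<phi> x) \<le> 1" for x
    proof -
      have "norm (\<phi> x) \<le> \<eta> (x \<bullet> u) * norm (\<phi>\<^sub>1 x) + (1 - \<eta> (x \<bullet> u)) * norm (\<phi>\<^sub>2 x)"
        unfolding \<phi>_def using \<eta>(3,4)[of "x \<bullet> u"] by (intro norm_triangle_le) simp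
      also have "\<dots> \<le> \<eta> (x \<bullet> u) * 1 + (1 - \<eta> (x \<bullet> u)) * 1"
        using \<eta>(3,4)[of "x \<bullet> u"] le by (intro add_mono mult_left_mono) auto
      finally show ?thesis by simp
    qed
    have div: "x \<in> E\<^sub>1 \<Longrightarrow> divergence \<phi> x = divergence \<phi>\<^sub>1 x"
      "x \<in> E\<^sub>2 \<Longrightarrow> divergence \<phi> x = divergence \<phi>\<^sub>2 x" for x
      using \<eta>_left[OF sep(1)] \<eta>_right[OF sep(2)]
      unfolding divergence_eq[OF der] divergence_eq[OF D\<^sub>1] divergence_eq[OF D\<^sub>2] D_def by simp_all
    have "(LINT x:E\<^sub>1 \<union> E\<^sub>2|lebesgue. divergence \<phi> x) =
        (LINT x:E\<^sub>1|lebesgue. divergence \<phi> x) + (LINT x:E\<^sub>2|lebesgue. divergence \<phi> x)"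
      by (intro set_integral_Un disj set_integrable_of_integrable integrable_divergence C1 meas)
    also have "(LINT x:E\<^sub>1|lebesgue. divergence \<phi> x) = (LINT x:E\<^sub>1|lebesgue. divergence \<phi>\<^sub>1 x)"
      using div meas by (intro set_lebesgue_integral_cong) auto
    also have "(LINT x:E\<^sub>2|lebesgue. divergence \<phi> x) = (LINT x:E\<^sub>2|lebesgue. divergence \<phi>\<^sub>2 x)"
      using div meas by (intro set_lebesgue_integral_cong) auto
    finally show ?thesis
      using perimeter_upper[OF C1 \<phi>_le, of "E\<^sub>1 \<union> E\<^sub>2"] by simp
  qed
  define A :: "('a \<Rightarrow> 'a) set" where "A = {\<phi>. C1_compact_support \<phi> \<and> (\<forall>x. norm (\<phi> x) \<le> 1)}"
  define I where "I E \<phi> = (LINT x:E|lebesgue. divergence \<phi> x)" for E and \<phi> :: "'a \<Rightarrow> 'a"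
  have zero: "(\<lambda>x. 0) \<in> A" "I E (\<lambda>x. 0) = 0" for E
    by (auto simp: A_def I_def)
  \<comment> \<open>The embedding \<open>ennreal\<close> is additive only on nonnegative numbers, so a field with negative
    integral is replaced by the zero field before gluing.\<close>
  have nonneg: "\<exists>\<psi>\<in>A. I E \<psi> \<ge> 0 \<and> ennreal (I E \<phi>) = ennreal (I E \<psi>)" if "\<phi> \<in> A" for E \<phi>
  proof (cases "I E \<phi> \<ge> 0")
    case False
    then show ?thesis
      using zero(1) zero(2)[of E] by (intro bexI[of _ "\<lambda>x. 0"]) (auto simp: ennreal_neg)
  qed (use that in auto)
  have pair: "ennreal (I E\<^sub>1 \<phi>\<^sub>1) + ennreal (I E\<^sub>2 \<phi>\<^sub>2) \<le> perimeter (E\<^sub>1 \<union> E\<^sub>2)"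
    if A: "\<phi>\<^sub>1 \<in> A" "\<phi>\<^sub>2 \<in> A" for \<phi>\<^sub>1 \<phi>\<^sub>2
  proof -
    obtain \<psi>\<^sub>1 where \<psi>\<^sub>1: "\<psi>\<^sub>1 \<in> A" "I E\<^sub>1 \<psi>\<^sub>1 \<ge> 0" "ennreal (I E\<^sub>1 \<phi>\<^sub>1) = ennreal (I E\<^sub>1 \<psi>\<^sub>1)"
      using nonneg[OF A(1)] by blast
    obtain \<psi>\<^sub>2 where \<psi>\<^sub>2: "\<psi>\<^sub>2 \<in> A" "I E\<^sub>2 \<psi>\<^sub>2 \<ge> 0" "ennreal (I E\<^sub>2 \<phi>\<^sub>2) = ennreal (I E\<^sub>2 \<psi>\<^sub>2)"
      using nonneg[OF A(2)] by blast
    show ?thesis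
      using glue[of \<psi>\<^sub>1 \<psi>\<^sub>2] \<psi>\<^sub>1 \<psi>\<^sub>2 unfolding A_def I_def by (simp add: ennreal_plus)
  qed
  have A: "A \<noteq> {}"
    using zero(1) by blast
  have "ennreal (I E\<^sub>1 \<phi>\<^sub>1) + (SUP \<phi>\<in>A. ennreal (I E\<^sub>2 \<phi>)) \<le> perimeter (E\<^sub>1 \<union> E\<^sub>2)"
    if "\<phi>\<^sub>1 \<in> A" for \<phi>\<^sub>1
    unfolding ennreal_SUP_add_right[OF A] by (intro SUP_least pair that)
  then have "(SUP \<phi>\<in>A. ennreal (I E\<^sub>1 \<phi>)) + (SUP \<phi>\<in>A. ennreal (I E\<^sub>2 \<phi>)) \<le> perimeter (E\<^sub>1 \<union> E\<^sub>2)"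
    unfolding ennreal_SUP_add_left[OF A, symmetric] by (intro SUP_least)
  then show ?thesis
    unfolding perimeter_def[of E\<^sub>1] perimeter_def[of E\<^sub>2] A_def I_def .
qed

text \<open>
  Multiplying out the quotient brings in the pieces of measure zero, which are excluded from the
  infimum but occur when a competitor is cut into parts.
\<close>

lemma cheeger_constant_times_le_perimeter:
  assumes E: "E \<in> sets lebesgue" "E \<subseteq> \<Omega>" and fin: "emeasure lebesgue E < top"
  shows "cheeger_constant \<Omega> * emeasure lebesgue E \<le> perimeter E"
proof (cases "emeasure lebesgue E = 0")
  case False
  then have "cheeger_constant \<Omega> \<le> perimeter E / emeasure lebesgue E"
    using E by (intro cheeger_constant_upper) (auto simp: zero_less_iff_neq_zero)
  then have "cheeger_constant \<Omega> * emeasure lebesgue E \<le>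
      perimeter E / emeasure lebesgue E * emeasure lebesgue E"
    by (rule mult_right_mono) simp
  also have "\<dots> = perimeter E"
    using False fin by (simp add: ennreal_divide_times mult_divide_eq_ennreal)
  finally show ?thesis .
qed simp

lemma cheeger_constant_lower_times:
  assumes "\<And>E. E \<in> sets lebesgue \<Longrightarrow> E \<subseteq> \<Omega> \<Longrightarrow> C * emeasure lebesgue E \<le> perimeter E"
    and "bounded \<Omega>"
  shows "C \<le> cheeger_constant \<Omega>"
proof (rule cheeger_constant_lower)
  fix E assume E: "E \<in> sets lebesgue" "E \<subseteq> \<Omega>" "emeasure lebesgue E > 0"
  have "E \<in> lmeasurable"
    using E assms(2) bounded_subset bounded_set_imp_lmeasurable by blast
  then have fin: "emeasure lebesgue E < top"
    unfolding fmeasurable_def infinity_ennreal_def by blast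
  have "C = C * emeasure lebesgue E / emeasure lebesgue E"
    using E(3) fin by (intro mult_divide_eq_ennreal[symmetric]) auto
  also have "\<dots> \<le> perimeter E / emeasure lebesgue E"
    by (intro divide_right_mono_ennreal assms(1) E)
  finally show "C \<le> perimeter E / emeasure lebesgue E" .
qed

text \<open>
  A competitor \<open>E\<close> splits into \<open>E \<inter> A\<close> and \<open>E \<inter> B\<close>, and both the volume and (as a lower bound) the
  perimeter are additive, so the quotient for \<open>E\<close> is at least a weighted mean of those for the pieces.
\<close>

lemma cheeger_constant_Un_separated:
  fixes u :: "'a::euclidean_space"
  assumes meas: "A \<in> sets lebesgue" "B \<in> sets lebesgue" and bdd: "bounded A" "bounded B"
    and sep: "\<And>x. x \<in> A \<Longrightarrow> x \<bullet> u \<le> a" "\<And>x. x \<in> B \<Longrightarrow> b \<le> x \<bullet> u" and "a < b"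
  shows "min (cheeger_constant A) (cheeger_constant B) \<le> cheeger_constant (A \<union> B)"
proof (rule cheeger_constant_lower_times)
  fix E assume E: "E \<in> sets lebesgue" "E \<subseteq> A \<union> B"
  let ?h = "min (cheeger_constant A) (cheeger_constant B)"
  have EAB: "E \<inter> A \<in> lmeasurable" "E \<inter> B \<in> lmeasurable"
    using E meas bdd by (auto intro!: bounded_set_imp_lmeasurable bounded_Int)
  then have fin: "emeasure lebesgue (E \<inter> A) < top" "emeasure lebesgue (E \<inter> B) < top"
    unfolding fmeasurable_def infinity_ennreal_def by blast+
  have un: "E = (E \<inter> A) \<union> (E \<inter> B)"
    using E by auto
  have "?h * emeasure lebesgue E = ?h * emeasure lebesgue (E \<inter> A) + ?h * emeasure lebesgue (E \<inter> B)"
  proof -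
    have "(E \<inter> A) \<inter> (E \<inter> B) = {}"
      using sep \<open>a < b\<close> by force
    then have "emeasure lebesgue (E \<inter> A) + emeasure lebesgue (E \<inter> B) = emeasure lebesgue E"
      using EAB un by (subst plus_emeasure) (auto dest: fmeasurableD)
    then show ?thesis by (simp flip: distrib_left)
  qed
  also have "\<dots> \<le> cheeger_constant A * emeasure lebesgue (E \<inter> A) +
      cheeger_constant B * emeasure lebesgue (E \<inter> B)"
    by (intro add_mono mult_right_mono) auto
  also have "\<dots> \<le> perimeter (E \<inter> A) + perimeter (E \<inter> B)"
    using EAB fin by (intro add_mono cheeger_constant_times_le_perimeter) (auto dest: fmeasurableD)
  also have "\<dots> \<le> perimeter ((E \<inter> A) \<union> (E \<inter> B))"
    by (rule perimeter_Un_separated[where u = u and a = a and b = b])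
      (use EAB sep \<open>a < b\<close> in \<open>auto dest: fmeasurableD\<close>)
  finally show "?h * emeasure lebesgue E \<le> perimeter E"
    using un by simp
qed (use bdd in auto)

section \<open>The Cheeger constant of a ball\<close>

text \<open>
  A single test field \<open>\<phi>\<close> with divergence at least \<open>\<kappa> > 0\<close> on the ball gives \<open>perimeter E \<ge> \<kappa> |E|\<close> for
  all competitors. The field is \<open>(max 0 (9 - |x|\<^sup>2))\<^sup>2 / 243\<close> times the radial field \<open>x\<close>. It vanishes outside
  the ball of radius 3, and there its norm is at most \<open>81 * 3 / 243 = 1\<close>. The radius 3 is large enough for
  the expansion \<open>n (9 - |x|\<^sup>2)\<close> of the radial field to beat the decay \<open>4 |x|\<^sup>2\<close> of the cutoff on the unit
  ball in every dimension \<open>n\<close>.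
\<close>

lemma cheeger_constant_unit_ball_pos:
  "cheeger_constant (ball (0::'a::euclidean_space) 1) > 0"
proof -
  define m where "m x = max 0 (9 - x \<bullet> x)" for x :: 'a
  define \<phi> where "\<phi> x = ((m x)\<^sup>2 / 243) *\<^sub>R x" for x :: 'a
  define D where "D x h = ((m x)\<^sup>2 / 243) *\<^sub>R h + (2 * m x * (- 2 * (x \<bullet> h)) / 243) *\<^sub>R x" for x h :: 'a
  have dm: "((\<lambda>x. (m x)\<^sup>2) has_derivative (\<lambda>h. - 2 * (x \<bullet> h) * (2 * m x))) (at x)" for x
    unfolding m_def
    by (rule DERIV_compose_FDERIV[OF has_real_derivative_max_zero_square])
      (auto intro!: derivative_eq_intros simp: inner_commute)
  have der: "(\<phi> has_derivative D x) (at x)" for x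
    unfolding \<phi>_def D_def
    by (rule derivative_eq_intros dm refl | simp)+ (simp add: fun_eq_iff algebra_simps)
  have out: "\<phi> x = 0" if "norm x \<ge> 3" for x
  proof -
    have "3\<^sup>2 \<le> (norm x)\<^sup>2"
      using that by (intro power_mono) auto
    then show ?thesis
      by (simp add: \<phi>_def m_def dot_square_norm)
  qed
  have C1: "C1_compact_support \<phi>"
  proof (rule C1_compact_supportI[OF der])
    show "continuous_on UNIV (\<lambda>x. D x b)" for b
      unfolding D_def m_def by (intro continuous_intros) auto
    have "{x. \<phi> x \<noteq> 0} \<subseteq> ball 0 3"
      using out by (force simp: not_le)
    then show "bounded {x. \<phi> x \<noteq> 0}"
      using bounded_subset by blast
  qed
  have le: "norm (\<phi> x) \<le> 1" for x
  proof (cases "norm x \<ge> 3")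
    case False
    have "(m x)\<^sup>2 \<le> 9\<^sup>2"
      unfolding m_def by (intro power_mono) auto
    then have "(m x)\<^sup>2 * norm x \<le> 81 * 3"
      using False by (intro mult_mono) auto
    then show ?thesis
      by (simp add: \<phi>_def)
  qed (simp add: out)
  have div: "divergence \<phi> x \<ge> 32 / 243" if "x \<in> ball 0 1" for x
  proof -
    have "norm x * norm x \<le> 1 * 1"
      using that by (intro mult_mono) auto
    then have r: "x \<bullet> x \<le> 1"
      by (simp add: dot_square_norm power2_eq_square)
    have d: "1 \<le> real DIM('a)"
      using DIM_positive[where 'a='a] by linarith
    have "divergence \<phi> x = (\<Sum>b\<in>Basis. (m x)\<^sup>2 / 243 - 4 * m x / 243 * ((x \<bullet> b) * (x \<bullet> b)))"
      unfolding divergence_eq[OF der] D_def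
      by (intro sum.cong) (simp_all add: inner_add_left algebra_simps)
    also have "\<dots> = m x * (m x * real DIM('a) - 4 * (x \<bullet> x)) / 243"
      unfolding sum_subtractf sum_distrib_left[symmetric] euclidean_inner[symmetric]
      by (simp add: algebra_simps power2_eq_square)
    finally have eq: "divergence \<phi> x = m x * (m x * real DIM('a) - 4 * (x \<bullet> x)) / 243" .
    have m: "8 \<le> m x"
      using r by (simp add: m_def)
    have "8 * 1 \<le> m x * real DIM('a)"
      using m d by (intro mult_mono) auto
    then have "8 * 4 \<le> m x * (m x * real DIM('a) - 4 * (x \<bullet> x))"
      using m r by (intro mult_mono) auto
    then show ?thesis
      unfolding eq by simp
  qed
  have "ennreal (32 / 243) \<le> cheeger_constant (ball (0::'a) 1)"
  proof (rule cheeger_constant_lower_times)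
    fix E :: "'a set"
    assume E: "E \<in> sets lebesgue" "E \<subseteq> ball 0 1"
    then have lm: "E \<in> lmeasurable"
      using bounded_subset bounded_ball bounded_set_imp_lmeasurable by blast
    then have fin: "emeasure lebesgue E < \<infinity>"
      unfolding fmeasurable_def by blast
    have "32 / 243 * measure lebesgue E = (LINT x:E|lebesgue. 32 / 243)"
      using set_integral_const[OF E(1), of "32 / 243 :: real"] fin by (simp add: less_top)
    also have "\<dots> \<le> (LINT x:E|lebesgue. divergence \<phi> x)"
    proof (rule set_integral_mono)
      show "set_integrable lebesgue E (\<lambda>x. 32 / 243 :: real)"
        using lm unfolding set_integrable_def lmeasurable_iff_integrable
        by (rule integrable_scaleR_left)
      show "set_integrable lebesgue E (divergence \<phi>)"
        by (intro set_integrable_of_integrable integrable_divergence C1 E)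
      show "32 / 243 \<le> divergence \<phi> x" if "x \<in> E" for x
        using that E div by blast
    qed
    finally have "ennreal (32 / 243 * measure lebesgue E) \<le> perimeter E"
      using perimeter_upper[OF C1 le, of E] ennreal_leI order_trans by blast
    moreover have "ennreal (32 / 243) * emeasure lebesgue E = ennreal (32 / 243 * measure lebesgue E)"
      unfolding emeasure_eq_measure2[OF lm] by (intro ennreal_mult'[symmetric]) simp
    ultimately show "ennreal (32 / 243) * emeasure lebesgue E \<le> perimeter E"
      by simp
  qed simp
  moreover have "(0::ennreal) < ennreal (32 / 243)"
    by simp
  ultimately show ?thesis
    by (rule less_le_trans[rotated])
qed

text \<open>
  Convexity of the power: the graph lies below its chord over the interval from 0 to 1.
\<close>

lemma power_one_plus_le:
  fixes e :: real
  assumes "0 \<le> e" "e \<le> 1"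
  shows "(1 + e) ^ n \<le> 1 + (2 ^ n - 1) * e"
proof (induction n)
  case (Suc n)
  have "(1 + e) ^ Suc n \<le> (1 + e) * (1 + (2 ^ n - 1) * e)"
    using Suc assms by simp
  also have "\<dots> = 1 + 2 ^ n * e + (2 ^ n - 1) * (e * e)"
    by (simp add: algebra_simps)
  also have "\<dots> \<le> 1 + 2 ^ n * e + (2 ^ n - 1) * e"
    using assms mult_left_le[of e e] by (intro add_left_mono mult_left_mono) auto
  finally show ?case by (simp add: algebra_simps)
qed simp

text \<open>
  Both integrals are over unit balls, with centres at distance \<open>|c|\<close>. They differ only on the shell
  between the balls of radius \<open>1 - |c|\<close> and \<open>1 + |c|\<close>, whose volume is of order \<open>|c|\<close>.
\<close>

lemma integral_unit_ball_translate:
  fixes f :: "'a::euclidean_space \<Rightarrow> real" and c :: 'a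
  assumes f: "integrable lebesgue f" "\<And>x. \<bar>f x\<bar> \<le> 1" and c: "norm c \<le> 1"
  defines "V \<equiv> measure lebesgue (ball (0::'a) 1)"
  shows "(LINT x:ball 0 1|lebesgue. f (x + c)) - (LINT x:ball 0 1|lebesgue. f x)
    \<le> (2 ^ DIM('a) - 1 + real DIM('a)) * V * norm c"
proof -
  let ?e = "norm c" and ?n = "DIM('a)"
  have vol: "measure lebesgue (ball (0::'a) r) = r ^ ?n * V" if "r \<ge> 0" for r
    using content_ball_conv_unit_ball[OF that, of "0::'a"] by (simp add: V_def)
  have int: "integrable lebesgue (indicator S :: 'a \<Rightarrow> real)" if "S \<in> lmeasurable" for S
    using that by (simp add: lmeasurable_iff_integrable)
  have intf: "integrable lebesgue (\<lambda>x. indicator (ball y r) x *\<^sub>R f x)" for y r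
    using f(1) by (intro integrable_mult_indicator) auto
  have "(LINT x:ball 0 1|lebesgue. f (x + c)) = (LINT x:ball c 1|lebesgue. f x)"
    using set_integral_affine_image[of 1 "ball 0 1" f c] f(1) ball_translation[of c 0 1]
    by (simp add: add.commute)
  then have "(LINT x:ball 0 1|lebesgue. f (x + c)) - (LINT x:ball 0 1|lebesgue. f x) =
      (LINT x|lebesgue. indicator (ball c 1) x *\<^sub>R f x - indicator (ball 0 1) x *\<^sub>R f x)"
    using intf by (simp add: set_lebesgue_integral_def)
  also have "\<dots> \<le> (LINT x::'a|lebesgue. indicator (ball 0 (1 + ?e)) x - indicator (ball 0 (1 - ?e)) x)"
  proof (rule Bochner_Integration.integral_mono)
    show "integrable lebesgue (\<lambda>x. indicator (ball c 1) x *\<^sub>R f x - indicator (ball 0 1) x *\<^sub>R f x)"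
      using intf by (intro Bochner_Integration.integrable_diff)
    show "integrable lebesgue (\<lambda>x::'a. indicator (ball 0 (1 + ?e)) x - indicator (ball 0 (1 - ?e)) x :: real)"
      by (intro Bochner_Integration.integrable_diff int) auto
    fix x :: 'a
    have f1: "- 1 \<le> f x" "f x \<le> 1"
      using f(2)[of x] by auto
    have "x \<in> ball c 1 \<or> x \<in> ball 0 1 \<Longrightarrow> x \<in> ball 0 (1 + ?e)"
      using norm_triangle_sub[of x c] norm_ge_zero[of c]
      by (auto simp: dist_norm norm_minus_commute simp del: norm_ge_zero)
    moreover have "x \<in> ball 0 (1 - ?e) \<Longrightarrow> x \<in> ball c 1 \<and> x \<in> ball 0 1"
      using norm_triangle_ineq4[of c x] norm_ge_zero[of c] by (auto simp: dist_norm simp del: norm_ge_zero)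
    ultimately show "indicator (ball c 1) x *\<^sub>R f x - indicator (ball 0 1) x *\<^sub>R f x \<le>
        indicator (ball 0 (1 + ?e)) x - indicator (ball 0 (1 - ?e)) x"
      using f1 by (auto simp: indicator_def simp del: mem_ball mem_ball_0)
  qed
  also have "\<dots> = measure lebesgue (ball (0::'a) (1 + ?e)) - measure lebesgue (ball (0::'a) (1 - ?e))"
    by (subst Bochner_Integration.integral_diff) (auto intro!: int)
  also have "\<dots> = ((1 + ?e) ^ ?n - (1 - ?e) ^ ?n) * V"
    using c vol[of "1 + ?e"] vol[of "1 - ?e"] by (simp add: left_diff_distrib)
  also have "\<dots> \<le> ((2 ^ ?n - 1 + real ?n) * ?e) * V"
  proof (rule mult_right_mono)
    have "1 - real ?n * ?e \<le> (1 - ?e) ^ ?n"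
      using Bernoulli_inequality[of "- ?e" ?n] c by simp
    then show "(1 + ?e) ^ ?n - (1 - ?e) ^ ?n \<le> (2 ^ ?n - 1 + real ?n) * ?e"
      using power_one_plus_le[of ?e ?n] c by (simp add: algebra_simps)
    show "0 \<le> V" by (simp add: V_def)
  qed
  finally show ?thesis
    by (simp add: algebra_simps)
qed

text \<open>
  Each term of the divergence is the limit of difference quotients in a coordinate direction \<open>b\<close>. For
  these, translating the integrand amounts to translating the ball, which changes the integral by
  \<open>O(e)\<close> for a step \<open>e\<close>. The bound \<open>M\<close> on the derivative depends on the test field and justifies the passage to the limit by
  dominated convergence, whereas \<open>C\<close> is uniform over all fields.
\<close>

lemma perimeter_unit_ball_finite:
  "perimeter (ball (0::'a::euclidean_space) 1) < top"
proof -
  let ?B = "ball (0::'a) 1"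
  define C where "C = (2 ^ DIM('a) - 1 + real DIM('a)) * measure lebesgue ?B"
  have "ennreal (LINT x:?B|lebesgue. divergence \<phi> x) \<le> ennreal (real DIM('a) * C)"
    if \<phi>: "C1_compact_support \<phi>" and le: "\<And>x. norm (\<phi> x) \<le> 1" for \<phi>
  proof -
    have partial: "(LINT x:?B|lebesgue. frechet_derivative \<phi> (at x) b \<bullet> b) \<le> C"
      if b: "b \<in> Basis" for b
    proof -
      define f where "f x = \<phi> x \<bullet> b" for x
      define g where "g x = frechet_derivative \<phi> (at x) b \<bullet> b" for x
      define e where "e n = inverse (real (Suc n))" for n
      define X where "X n x = indicator ?B x *\<^sub>R ((f (x + e n *\<^sub>R b) - f x) / e n)" for n x
      obtain M where M: "\<And>x. \<bar>g x\<bar> \<le> M"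
        using partial_derivative_facts(3)[OF \<phi> b] unfolding g_def by blast
      have e: "0 < e n" "e n \<le> 1" for n
        by (auto simp: e_def field_simps)
      have dir: "((\<lambda>t. f (x + t *\<^sub>R b)) has_real_derivative g (x + t *\<^sub>R b)) (at t)" for x t
      proof -
        let ?D = "frechet_derivative \<phi> (at (x + t *\<^sub>R b))"
        have D: "(\<phi> has_derivative ?D) (at (x + t *\<^sub>R b))"
          by (rule C1_compact_supportD(1)[OF \<phi>])
        have "((\<lambda>t. \<phi> (x + t *\<^sub>R b)) has_derivative (\<lambda>s. ?D (s *\<^sub>R b))) (at t)"
          by (rule has_derivative_compose[where g = \<phi> and f = "\<lambda>t. x + t *\<^sub>R b", OF _ D]) (auto intro!: derivative_eq_intros)
        then have "((\<lambda>t. f (x + t *\<^sub>R b)) has_derivative (\<lambda>s. ?D (s *\<^sub>R b) \<bullet> b)) (at t)"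
          unfolding f_def by (rule has_derivative_inner_left)
        moreover have "(\<lambda>s. ?D (s *\<^sub>R b) \<bullet> b) = (*) (g (x + t *\<^sub>R b))"
          using has_derivative_bounded_linear[OF D]
          by (auto simp: fun_eq_iff g_def bounded_linear.linear linear_scale)
        ultimately show ?thesis
          by (simp add: has_field_derivative_def)
      qed
      have cont: "continuous_on UNIV f"
        unfolding f_def using has_derivative_continuous[OF C1_compact_supportD(1)[OF \<phi>]]
        by (intro continuous_intros continuous_at_imp_continuous_on) blast
      have f_int: "integrable lebesgue f"
      proof (rule integrable_lebesgue_continuous_compact_support[OF cont])
        show "compact (closure {x. \<phi> x \<noteq> 0})"
          using C1_compact_supportD(3)[OF \<phi>] by simp
        show "f x = 0" if "x \<notin> closure {x. \<phi> x \<noteq> 0}" for x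
        proof -
          have "\<phi> x = 0"
            using that closure_subset[of "{x. \<phi> x \<noteq> 0}"] by blast
          then show ?thesis by (simp add: f_def)
        qed
      qed
      have f_le: "\<bar>f x\<bar> \<le> 1" for x
        using Cauchy_Schwarz_ineq2[of "\<phi> x" b] le[of x] b by (simp add: f_def)
      have shift: "(\<lambda>x. f (x + c)) \<in> borel_measurable lebesgue" for c
      proof -
        have "continuous_on UNIV (\<lambda>x. f (x + c))"
          by (intro continuous_on_compose2[OF cont] continuous_intros) auto
        then show ?thesis
          by (intro measurable_completion) (simp add: borel_measurable_continuous_onI)
      qed
      have meas: "X n \<in> borel_measurable lebesgue" for n
        unfolding X_def using shift[of "e n *\<^sub>R b"] shift[of 0]
        by (intro borel_measurable_scaleR borel_measurable_divide borel_measurable_diff borel_measurable_indicator) auto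
      have lim: "(\<lambda>n. integral\<^sup>L lebesgue (X n)) \<longlonglongrightarrow>
          integral\<^sup>L lebesgue (\<lambda>x. indicator ?B x *\<^sub>R g x)"
      proof (rule integral_dominated_convergence[where w = "\<lambda>x. M * indicator ?B x"])
        show "(\<lambda>x. indicator ?B x *\<^sub>R g x) \<in> borel_measurable lebesgue"
          using partial_derivative_facts(2)[OF \<phi> b] unfolding g_def
          by (intro borel_measurable_scaleR borel_measurable_indicator borel_measurable_integrable) auto
        have "integrable lebesgue (indicator ?B :: 'a \<Rightarrow> real)"
          using lmeasurable_ball[of "0::'a" 1] by (simp only: lmeasurable_iff_integrable)
        then show "integrable lebesgue (\<lambda>x. M * indicator ?B x)"
          by simp
        show "AE x in lebesgue. (\<lambda>n. X n x) \<longlonglongrightarrow> indicator ?B x *\<^sub>R g x"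
        proof (intro AE_I2 allI)
          fix x
          have "((\<lambda>t. (f (x + t *\<^sub>R b) - f x) / t) \<longlongrightarrow> g x) (at 0)"
            using dir[of x 0] unfolding DERIV_def by simp
          moreover have "filterlim e (at 0) sequentially"
            using LIMSEQ_inverse_real_of_nat e unfolding filterlim_at e_def
            by (auto simp del: of_nat_Suc intro!: always_eventually)
          ultimately have "(\<lambda>n. (f (x + e n *\<^sub>R b) - f x) / e n) \<longlonglongrightarrow> g x"
            by (rule filterlim_compose)
          then show "(\<lambda>n. X n x) \<longlonglongrightarrow> indicator ?B x *\<^sub>R g x"
            unfolding X_def by (intro tendsto_intros)
        qed
        show "AE x in lebesgue. norm (X n x) \<le> M * indicator ?B x" for n
        proof (intro AE_I2)
          fix x
          obtain z where "f (x + e n *\<^sub>R b) - f (x + 0 *\<^sub>R b) = (e n - 0) * g (x + z *\<^sub>R b)"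
            using MVT2[OF e(1)[of n], of "\<lambda>t. f (x + t *\<^sub>R b)" "\<lambda>t. g (x + t *\<^sub>R b)"] dir by blast
          then have "(f (x + e n *\<^sub>R b) - f x) / e n = g (x + z *\<^sub>R b)"
            using e(1)[of n] by (simp add: field_simps)
          then show "norm (X n x) \<le> M * indicator ?B x"
            unfolding X_def using M by (simp add: indicator_def)
        qed
      qed (rule meas)
      have "integral\<^sup>L lebesgue (X n) \<le> C" for n
      proof -
        have sf: "set_integrable lebesgue ?B f"
          by (intro set_integrable_of_integrable f_int) simp
        have "integrable lebesgue (\<lambda>x. f (1 *\<^sub>R x + e n *\<^sub>R b))"
        proof (rule integrable_lebesgue_continuous_compact_support)
          show "continuous_on UNIV (\<lambda>x. f (1 *\<^sub>R x + e n *\<^sub>R b))"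
            by (intro continuous_on_compose2[OF cont] continuous_intros) auto
          show "compact ((+) (- e n *\<^sub>R b) ` closure {x. \<phi> x \<noteq> 0})"
            using C1_compact_supportD(3)[OF \<phi>] by (intro compact_translation) simp
          fix x assume x: "x \<notin> (+) (- e n *\<^sub>R b) ` closure {x. \<phi> x \<noteq> 0}"
          have "x + e n *\<^sub>R b \<notin> closure {x. \<phi> x \<noteq> 0}"
            using x by (force simp: image_iff algebra_simps)
          then have "\<phi> (x + e n *\<^sub>R b) = 0"
            using closure_subset[of "{x. \<phi> x \<noteq> 0}"] by blast
          then show "f (1 *\<^sub>R x + e n *\<^sub>R b) = 0"
            by (simp add: f_def)
        qed
        then have sf': "set_integrable lebesgue ?B (\<lambda>x. f (x + e n *\<^sub>R b))"
          by (intro set_integrable_of_integrable) auto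
        have "integral\<^sup>L lebesgue (X n) = (LINT x:?B|lebesgue. (f (x + e n *\<^sub>R b) - f x) / e n)"
          unfolding X_def[abs_def] set_lebesgue_integral_def ..
        also have "\<dots> = ((LINT x:?B|lebesgue. f (x + e n *\<^sub>R b)) - (LINT x:?B|lebesgue. f x)) / e n"
          using set_integral_diff(2)[OF sf' sf] by simp
        also have "\<dots> \<le> C * e n / e n"
        proof (rule divide_right_mono)
          show "(LINT x:?B|lebesgue. f (x + e n *\<^sub>R b)) - (LINT x:?B|lebesgue. f x) \<le> C * e n"
            using integral_unit_ball_translate[OF f_int f_le, of "e n *\<^sub>R b"] e[of n] b
            by (simp add: C_def)
        qed (use e(1)[of n] in simp)
        also have "\<dots> = C"
          using e(1)[of n] by simp
        finally show ?thesis .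
      qed
      then have "integral\<^sup>L lebesgue (\<lambda>x. indicator ?B x *\<^sub>R g x) \<le> C"
        by (intro LIMSEQ_le_const2[OF lim]) auto
      then show ?thesis
        by (simp add: set_lebesgue_integral_def g_def)
    qed
    have "(LINT x:?B|lebesgue. divergence \<phi> x) =
        (\<Sum>b\<in>Basis. LINT x:?B|lebesgue. frechet_derivative \<phi> (at x) b \<bullet> b)"
      unfolding divergence_def set_lebesgue_integral_def scaleR_sum_right
      by (intro Bochner_Integration.integral_sum integrable_mult_indicator
          partial_derivative_facts(2)[OF \<phi>]) auto
    also have "\<dots> \<le> (\<Sum>b\<in>(Basis::'a set). C)"
      by (intro sum_mono partial)
    finally show ?thesis
      by (intro ennreal_leI) simp
  qed
  then have "perimeter ?B \<le> ennreal (real DIM('a) * C)"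
    by (rule perimeter_least)
  then show ?thesis
    using ennreal_less_top le_less_trans by blast
qed

lemma cheeger_constant_unit_ball_finite:
  "cheeger_constant (ball (0::'a::euclidean_space) 1) < top"
proof -
  let ?B = "ball (0::'a) 1"
  have "measure lebesgue ?B > 0"
    using content_ball_pos[of 1 "0::'a"] by simp
  then have pos: "emeasure lebesgue ?B > 0"
    by (metis emeasure_eq_measure2 ennreal_eq_zero_iff lmeasurable_ball measure_nonneg not_gr_zero order_less_irrefl)
  then have "cheeger_constant ?B \<le> perimeter ?B / emeasure lebesgue ?B"
    by (intro cheeger_constant_upper) auto
  also have "\<dots> < top"
    using perimeter_unit_ball_finite[where 'a='a] pos ennreal_divide_eq_top_iff less_top
      zero_less_iff_neq_zero by metis
  finally show ?thesis .
qed

lemma affine_image_ball: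
  fixes a c :: "'a::euclidean_space"
  assumes "r > 0"
  shows "(\<lambda>x. r *\<^sub>R x + c) ` ball a s = ball (r *\<^sub>R a + c) (r * s)"
proof -
  have "(\<lambda>x. r *\<^sub>R x + c) ` ball a s = (+) c ` (\<lambda>x. r *\<^sub>R x) ` ball a s"
    by (auto simp: image_iff add.commute)
  also have "\<dots> = ball (c + r *\<^sub>R a) (r * s)"
    using assms ball_scale[of r a s] ball_translation[of c "r *\<^sub>R a" "r * s"] by simp
  finally show ?thesis by (simp only: add.commute)
qed

lemma cheeger_constant_ball:
  fixes c :: "'a::euclidean_space"
  assumes r: "r > 0"
  shows "cheeger_constant (ball c r) = ennreal (1 / r) * cheeger_constant (ball (0::'a) 1)"
proof (rule antisym)
  have "ennreal r * cheeger_constant (ball c r) \<le> cheeger_constant (ball (0::'a) 1)"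
    using cheeger_constant_affine_image[OF r, of c "ball 0 1"] r by (simp add: affine_image_ball)
  then have "ennreal (1 / r) * (ennreal r * cheeger_constant (ball c r)) \<le>
      ennreal (1 / r) * cheeger_constant (ball (0::'a) 1)"
    by (rule mult_left_mono) simp
  moreover have "ennreal (1 / r) * ennreal r = 1"
    using r by (simp flip: ennreal_mult')
  ultimately show "cheeger_constant (ball c r) \<le> ennreal (1 / r) * cheeger_constant (ball (0::'a) 1)"
    by (simp flip: mult.assoc)
  have "(\<lambda>x. (1 / r) *\<^sub>R x + (- (1 / r) *\<^sub>R c)) ` ball c r = ball 0 1"
    using r by (subst affine_image_ball) auto
  then show "ennreal (1 / r) * cheeger_constant (ball (0::'a) 1) \<le> cheeger_constant (ball c r)"
    using cheeger_constant_affine_image[of "1 / r" "- (1 / r) *\<^sub>R c" "ball c r"] r by simp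
qed

section \<open>Two discs\<close>

lemma inner_parallel_set_ball:
  assumes "t \<ge> 0"
  shows "inner_parallel_set (ball (c::'a::euclidean_space) r) t = ball c (r - t)"
  using assms by (auto simp: inner_parallel_set_def cball_subset_ball_iff dist_commute)

text \<open>
  A closed ball is connected, so it cannot meet both of two disjoint open sets that cover it.
\<close>

lemma inner_parallel_set_Un_disjoint:
  fixes A B :: "'a::euclidean_space set"
  assumes "open A" "open B" "A \<inter> B = {}"
  shows "inner_parallel_set (A \<union> B) t = inner_parallel_set A t \<union> inner_parallel_set B t"
proof -
  have "cball x t \<subseteq> A \<or> cball x t \<subseteq> B" if "cball x t \<subseteq> A \<union> B" for x
    using connectedD[OF connected_cball assms(1,2), of x t] that assms(3) by blast
  then show ?thesis
    unfolding inner_parallel_set_def by blast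
qed

theorem proposition4p1:
  "\<exists>\<Omega> :: (real ^ 2) set. bounded \<Omega> \<and> open \<Omega> \<and>
     (\<forall>\<^sub>F t in at_right 0.
        ennreal (sqrt (measure lebesgue (inner_parallel_set \<Omega> t)))
            * cheeger_constant (inner_parallel_set \<Omega> t)
          < ennreal (sqrt (measure lebesgue \<Omega>)) * cheeger_constant \<Omega>)"
proof -
  obtain u :: "real ^ 2" where u: "norm u = 1"
    using vector_choose_size[of 1] by auto
  \<comment> \<open>With this centre, the strip \<open>2 < x \<bullet> u < 4\<close> separates the two discs.\<close>
  define c where "c = 5 *\<^sub>R u"
  have uu: "u \<bullet> u = 1"
    using u by (simp add: dot_square_norm)
  have left: "x \<bullet> u \<le> 2" if "x \<in> ball 0 2" for x
    using Cauchy_Schwarz_ineq2[of x u] u that by simp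
  have right: "4 \<le> x \<bullet> u" if "x \<in> ball c 1" for x
  proof -
    have "(c - x) \<bullet> u \<le> 1"
      using Cauchy_Schwarz_ineq2[of "c - x" u] u that by (simp add: dist_norm)
    then show ?thesis
      by (simp add: inner_diff_left c_def uu)
  qed
  have disj: "ball 0 2 \<inter> ball c 1 = {}"
    using left right by force
  define \<Omega> where "\<Omega> = ball 0 2 \<union> ball c 1"
  define h where "h = enn2real (cheeger_constant (ball (0 :: real ^ 2) 1))"
  define V where "V = measure lebesgue (ball (0 :: real ^ 2) 1)"
  have V: "V > 0"
    using content_ball_pos[of 1 "0 :: real ^ 2"] by (simp add: V_def)
  have h: "cheeger_constant (ball (0 :: real ^ 2) 1) = ennreal h" "h > 0"
    using cheeger_constant_unit_ball_finite[where 'a = "real ^ 2"]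
      cheeger_constant_unit_ball_pos[where 'a = "real ^ 2"]
    by (auto simp: h_def enn2real_positive_iff)
  have vol: "measure lebesgue (ball 0 r \<union> ball c s) = V * (r\<^sup>2 + s\<^sup>2)"
    if "0 \<le> r" "r \<le> 2" "0 \<le> s" "s \<le> 1" for r s
  proof -
    have "ball 0 r \<inter> ball c s = {}"
      using disj subset_ball[of r 2 0] subset_ball[of s 1 c] that by blast
    then have "measure lebesgue (ball 0 r \<union> ball c s) =
        measure lebesgue (ball (0 :: real ^ 2) r) + measure lebesgue (ball c s)"
      by (intro measure_Un3[THEN trans]) auto
    then show ?thesis
      using that content_ball_conv_unit_ball[of r "0 :: real ^ 2"] content_ball_conv_unit_ball[of s c]
      by (simp add: V_def algebra_simps power2_eq_square)
  qed
  have cheeger_ball: "cheeger_constant (ball (a :: real ^ 2) r) = ennreal (h / r)" if "r > 0" for a r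
    unfolding cheeger_constant_ball[OF that] h(1) using that h(2)
    by (subst ennreal_mult'[symmetric]) auto
  have lower: "ennreal (h / 2) \<le> cheeger_constant \<Omega>"
  proof -
    have "ennreal (h / 2) \<le> min (cheeger_constant (ball (0 :: real ^ 2) 2)) (cheeger_constant (ball c 1))"
      using h(2) by (simp add: cheeger_ball ennreal_leI)
    also have "\<dots> \<le> cheeger_constant \<Omega>"
      unfolding \<Omega>_def
      by (rule cheeger_constant_Un_separated[where u = u and a = 2 and b = 4]) (use left right in auto)
    finally show ?thesis .
  qed
  have strict: "ennreal (sqrt (measure lebesgue (inner_parallel_set \<Omega> t))) * cheeger_constant (inner_parallel_set \<Omega> t)
      < ennreal (sqrt (measure lebesgue \<Omega>)) * cheeger_constant \<Omega>" if t: "0 < t" "t < 1" for t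
  proof -
    let ?W = "V * ((2 - t)\<^sup>2 + (1 - t)\<^sup>2)"
    have inner: "inner_parallel_set \<Omega> t = ball 0 (2 - t) \<union> ball c (1 - t)"
      unfolding \<Omega>_def using t disj by (simp add: inner_parallel_set_Un_disjoint inner_parallel_set_ball)
    \<comment> \<open>An upper bound for the Cheeger constant needs only the larger disc as a competitor.\<close>
    have "cheeger_constant (inner_parallel_set \<Omega> t) \<le> cheeger_constant (ball (0 :: real ^ 2) (2 - t))"
      unfolding inner by (rule cheeger_constant_antimono) simp
    also have "\<dots> = ennreal (h / (2 - t))"
      using t by (simp add: cheeger_ball)
    finally have "ennreal (sqrt (measure lebesgue (inner_parallel_set \<Omega> t))) * cheeger_constant (inner_parallel_set \<Omega> t)
        \<le> ennreal (sqrt ?W) * ennreal (h / (2 - t))"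
      using vol[of "2 - t" "1 - t"] t unfolding inner by (intro mult_mono) auto
    also have "\<dots> = ennreal (sqrt ?W * (h / (2 - t)))"
      using V by (intro ennreal_mult'[symmetric]) auto
    also have "\<dots> < ennreal (sqrt (V * 5) * (h / 2))"
    proof (rule ennreal_lessI)
      \<comment> \<open>The relative loss of radius, \<open>t\<close> against \<open>t / 2\<close>, is greater for the smaller disc.\<close>
      have "2 * (1 - t) * (2 * (1 - t)) < (2 - t) * (2 - t)"
        using t by (intro mult_strict_mono) auto
      then have "((2 - t)\<^sup>2 + (1 - t)\<^sup>2) * 2\<^sup>2 < 5 * (2 - t)\<^sup>2"
        by (simp add: power2_eq_square algebra_simps)
      then have "?W * 2\<^sup>2 < V * 5 * (2 - t)\<^sup>2"
        using V by (simp add: mult.assoc)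
      then have "sqrt (?W * 2\<^sup>2) < sqrt (V * 5 * (2 - t)\<^sup>2)"
        by (rule real_sqrt_less_mono)
      then have "sqrt ?W * 2 < sqrt (V * 5) * (2 - t)"
        using t by (simp only: real_sqrt_mult[of _ "2\<^sup>2"] real_sqrt_mult[of _ "(2 - t)\<^sup>2"] real_sqrt_abs)
      then have "sqrt ?W / (2 - t) < sqrt (V * 5) / 2"
        using t by (simp add: field_simps)
      then have "sqrt ?W / (2 - t) * h < sqrt (V * 5) / 2 * h"
        using h(2) by (rule mult_strict_right_mono)
      then show "sqrt ?W * (h / (2 - t)) < sqrt (V * 5) * (h / 2)"
        by simp
      show "0 < sqrt (V * 5) * (h / 2)"
        using V h(2) by simp
    qed
    also have "\<dots> = ennreal (sqrt (measure lebesgue \<Omega>)) * ennreal (h / 2)"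
      using vol[of 2 1] V by (simp add: \<Omega>_def ennreal_mult'[symmetric])
    also have "\<dots> \<le> ennreal (sqrt (measure lebesgue \<Omega>)) * cheeger_constant \<Omega>"
      by (intro mult_left_mono lower) simp
    finally show ?thesis .
  qed
  have "\<forall>\<^sub>F t in at_right 0. 0 < t \<and> t < (1::real)"
    by (rule eventually_at_rightI[of 0 1]) auto
  then have "\<forall>\<^sub>F t in at_right 0.
      ennreal (sqrt (measure lebesgue (inner_parallel_set \<Omega> t))) * cheeger_constant (inner_parallel_set \<Omega> t)
      < ennreal (sqrt (measure lebesgue \<Omega>)) * cheeger_constant \<Omega>"
    by (rule eventually_mono) (use strict in blast)
  moreover have "bounded \<Omega>" "open \<Omega>"
    by (auto simp: \<Omega>_def)
  ultimately show ?thesis by blast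
qed

end
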